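(* Let $n\ge 2$, let $F:2^{[n]}\to\mathbb R$ satisfy $F(\varnothing)=0$, and set $D(H)=|H|-F(H)$ for $H\subseteq[n]$. The following are equivalent: (i) $F$ is the discrimination-error profile of $n$ states in a finite-dimensional GPT state space. (ii) There exist finitely many $c^{(1)},\ldots,c^{(r)}\in\mathcal C_n$ such that $D(H)=\max_{1\le\alpha\le r}\theta_{c^{(\alpha)}}(H)$ for every $H\subseteq[n]$. (iii) There exist finitely many $c^{(1)},\ldots,c^{(r)}\in\mathcal C_n$ such that $F(H)=\min_{1\le\alpha\le r}E_{c^{(\alpha)}}(H)$ for every $H\subseteq[n]$. Moreover, one may always take $1\le r\le 2^n-n-1$, and every such profile $F$ has a realization by $n$ states in a finite Cartesian product of classical probability simplexes (viewed as a compact convex state space, with all affine measurements allowed).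
   Context: $[n]=\{1,\ldots,n\}$. A finite-dimensional GPT state space is a nonempty compact convex subset $K$ of some $\mathbb R^d$, $d\ge1$. A (finite-outcome) measurement on $K$ is a finite family $(e_x)_{x\in X}$ of nonnegative affine functions on $K$ with $\sum_{x}e_x=1$; every such family is allowed. For a list of (not necessarily distinct) states $s_1,\ldots,s_n\in K$ and nonempty $H\subseteq[n]$, the optimal success is $D(H)=\max\sum_{i\in H}e_i(s_i)$, the maximum over all measurements $(e_i)_{i\in H}$ indexed by $H$ (zero effects allowed), and $F(H)=|H|-D(H)$; also $D(\varnothing)=F(\varnothing)=0$. The set function $F$ is the discrimination-error profile of the list. A classical probability simplex is $\Delta_m=\{p\in\mathbb R^m:p_j\ge0,\ \sum_jp_j=1\}$. The coefficient polytope is $\mathcal C_n=\{(c_B)_{\varnothing\ne B\subseteq[n]}: c_B\ge0,\ \sum_{B\ni i}c_B=1\text{ for all }i\in[n]\}$. For $c\in\mathcal C_n$ and $H\subseteq[n]$, $\theta_c(H)=\sum_{B:\,B\cap H\ne\varnothing}c_B$ and $E_c(H)=|H|-\theta_c(H)$. *)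

theory Defs
  imports "HOL-Analysis.Analysis"
begin

text \<open>
  Points of \<open>\<real>\<^sup>d\<close> are functions \<open>nat \<Rightarrow> real\<close> vanishing at all arguments \<open>\<ge> d\<close>, as in
  \<^const>\<open>Euclidean_space\<close>, so that the dimension can be quantified existentially. This
  function type is not an instance of \<^class>\<open>real_vector\<close>; convex combinations are
  therefore written out.
\<close>

definition mix :: "real \<Rightarrow> (nat \<Rightarrow> real) \<Rightarrow> (nat \<Rightarrow> real) \<Rightarrow> nat \<Rightarrow> real" where
  "mix u x y = (\<lambda>i. (1 - u) * x i + u * y i)"

definition gpt_state_space :: "nat \<Rightarrow> (nat \<Rightarrow> real) set \<Rightarrow> bool" where
  "gpt_state_space d K \<longleftrightarrow>
     1 \<le> d \<and> K \<noteq> {} \<and> compactin (Euclidean_space d) K \<and>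
     (\<forall>x\<in>K. \<forall>y\<in>K. \<forall>u\<in>{0..1}. mix u x y \<in> K)"

definition affine_fun_on :: "(nat \<Rightarrow> real) set \<Rightarrow> ((nat \<Rightarrow> real) \<Rightarrow> real) \<Rightarrow> bool" where
  "affine_fun_on K f \<longleftrightarrow>
     (\<forall>x\<in>K. \<forall>y\<in>K. \<forall>u\<in>{0..1}. f (mix u x y) = (1 - u) * f x + u * f y)"

definition measurement ::
    "(nat \<Rightarrow> real) set \<Rightarrow> 'x set \<Rightarrow> ('x \<Rightarrow> (nat \<Rightarrow> real) \<Rightarrow> real) \<Rightarrow> bool" where
  "measurement K X e \<longleftrightarrow>
     finite X \<and>
     (\<forall>x\<in>X. affine_fun_on K (e x) \<and> (\<forall>s\<in>K. 0 \<le> e x s)) \<and>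
     (\<forall>s\<in>K. (\<Sum>x\<in>X. e x s) = 1)"

text \<open>
  \<^const>\<open>Greatest\<close> denotes the attained maximum. On a state space it exists for every
  nonempty finite \<open>H\<close>: the measurements indexed by \<open>H\<close> form a compact subset of
  \<open>[0,1]\<close>-valued functions on \<open>H \<times> K\<close> under pointwise convergence.
\<close>

definition opt_success ::
    "(nat \<Rightarrow> real) set \<Rightarrow> (nat \<Rightarrow> nat \<Rightarrow> real) \<Rightarrow> nat set \<Rightarrow> real" where
  "opt_success K s H =
     (if H = {} then 0
      else (GREATEST v. \<exists>e. measurement K H e \<and> v = (\<Sum>i\<in>H. e i (s i))))"

definition error_profile ::
    "(nat \<Rightarrow> real) set \<Rightarrow> (nat \<Rightarrow> nat \<Rightarrow> real) \<Rightarrow> nat set \<Rightarrow> real" where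
  "error_profile K s H = real (card H) - opt_success K s H"

text \<open>
  Set functions on the subsets of \<open>{1..n}\<close> are total functions on \<^typ>\<open>nat set\<close> of which
  only the values at subsets of \<open>{1..n}\<close> matter.
\<close>

definition profile_realized_in ::
    "nat \<Rightarrow> (nat set \<Rightarrow> real) \<Rightarrow> (nat \<Rightarrow> real) set \<Rightarrow> bool" where
  "profile_realized_in n F K \<longleftrightarrow>
     (\<exists>s. (\<forall>i\<in>{1..n}. s i \<in> K) \<and> (\<forall>H\<subseteq>{1..n}. F H = error_profile K s H))"

definition gpt_profile :: "nat \<Rightarrow> (nat set \<Rightarrow> real) \<Rightarrow> bool" where
  "gpt_profile n F \<longleftrightarrow> (\<exists>d K. gpt_state_space d K \<and> profile_realized_in n F K)"

definition prob_simplex :: "nat \<Rightarrow> (nat \<Rightarrow> real) set" where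
  "prob_simplex m =
     {p \<in> topspace (Euclidean_space m). (\<forall>j<m. 0 \<le> p j) \<and> (\<Sum>j<m. p j) = 1}"

text \<open>
  A point of the product of \<open>\<real>\<^sup>m\<close> over the entries \<open>m\<close> of a list \<open>ms\<close> is the concatenation
  of its components; \<open>block ms k x\<close> is the \<open>k\<close>-th component (counting from \<open>0\<close>) of \<open>x\<close>.
\<close>

definition block :: "nat list \<Rightarrow> nat \<Rightarrow> (nat \<Rightarrow> real) \<Rightarrow> nat \<Rightarrow> real" where
  "block ms k x = (\<lambda>j. if j < ms ! k then x (sum_list (take k ms) + j) else 0)"

definition simplex_product :: "nat list \<Rightarrow> (nat \<Rightarrow> real) set" where
  "simplex_product ms =
     {x \<in> topspace (Euclidean_space (sum_list ms)).
        \<forall>k<length ms. block ms k x \<in> prob_simplex (ms ! k)}"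

definition coeff_polytope :: "nat \<Rightarrow> (nat set \<Rightarrow> real) set" where
  "coeff_polytope n =
     {c \<in> (Pow {1..n} - {{}}) \<rightarrow>\<^sub>E {0..}.
        \<forall>i\<in>{1..n}. (\<Sum>B\<in>{B. B \<subseteq> {1..n} \<and> i \<in> B}. c B) = 1}"

definition theta :: "nat \<Rightarrow> (nat set \<Rightarrow> real) \<Rightarrow> nat set \<Rightarrow> real" where
  "theta n c H = (\<Sum>B\<in>{B. B \<subseteq> {1..n} \<and> B \<inter> H \<noteq> {}}. c B)"

definition E_fun :: "nat \<Rightarrow> (nat set \<Rightarrow> real) \<Rightarrow> nat set \<Rightarrow> real" where
  "E_fun n c H = real (card H) - theta n c H"

definition max_theta_rep :: "nat \<Rightarrow> nat \<Rightarrow> (nat set \<Rightarrow> real) \<Rightarrow> bool" where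
  "max_theta_rep n r D \<longleftrightarrow>
     (\<exists>c. (\<forall>\<alpha>\<in>{1..r}. c \<alpha> \<in> coeff_polytope n) \<and>
          (\<forall>H\<subseteq>{1..n}. D H = Max ((\<lambda>\<alpha>. theta n (c \<alpha>) H) ` {1..r})))"

definition min_E_rep :: "nat \<Rightarrow> nat \<Rightarrow> (nat set \<Rightarrow> real) \<Rightarrow> bool" where
  "min_E_rep n r F \<longleftrightarrow>
     (\<exists>c. (\<forall>\<alpha>\<in>{1..r}. c \<alpha> \<in> coeff_polytope n) \<and>
          (\<forall>H\<subseteq>{1..n}. F H = Min ((\<lambda>\<alpha>. E_fun n (c \<alpha>) H) ` {1..r})))"

end

theory Submission imports Defs begin

text \<open>
  An outcome \<open>x\<close> of an optimal measurement for \<open>H\<close> gives the vector \<open>i \<mapsto> e\<^sub>x(s\<^sub>i)\<close>. Its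
  layer-cake decomposition into indicators of level sets \<open>B\<close> turns \<open>max\<^bsub>i\<in>G\<^esub> e\<^sub>x(s\<^sub>i)\<close> into the
  total weight of the \<open>B\<close> meeting \<open>G\<close>. Summed over \<open>x\<close>, the weights form a point \<open>c\<close> of the
  coefficient polytope, and \<open>\<theta>\<^sub>c(G)\<close> is the success for \<open>G\<close> of the best post-processing of that
  measurement: at most \<open>D(G)\<close>, with equality at \<open>G = H\<close>. Only \<open>H\<close> with at least two elements
  need their own \<open>c\<close>.

  Conversely, take one simplex per \<open>c\<^bsup>(\<alpha>)\<^esup>\<close>, with vertices labelled by subsets \<open>B\<close>, and let the
  \<open>\<alpha>\<close>-component of \<open>s\<^sub>i\<close> have weight \<open>c\<^bsup>(\<alpha>)\<^esup>(B)\<close> at each \<open>B\<close> containing \<open>i\<close>. A nonnegative affine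
  function on a product of simplexes is a sum of nonnegative functions of the single components, so
  a measurement amounts to choosing a component at random and measuring it; the optimum is
  attained on one component, where it equals \<open>\<theta>\<close>.
\<close>

section \<open>From state spaces to coefficients\<close>

lemma closed_Collect_ball:
  "(\<And>x. x \<in> A \<Longrightarrow> closed {e. P x e}) \<Longrightarrow> closed {e. \<forall>x\<in>A. P x e}"
  by (simp add: Collect_ball_eq closed_INT)

lemma compact_PiE_UNIV:
  fixes S :: "'a \<Rightarrow> 'b::topological_space set"
  assumes "\<And>i. compact (S i)"
  shows "compact (PiE UNIV S)"
  using compactin_PiE[of "\<lambda>_. euclidean" UNIV S] assms
  by (simp add: euclidean_product_topology)

text \<open>Makes \<open>Greatest\<close> usable. By Tychonoff the candidate effects form a compact
  box under pointwise convergence; affinity and normalization are pointwise equations, hence closed,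
  and the success is a finite sum of coordinates, hence continuous.\<close>

lemma opt_success_attained:
  assumes H: "finite H" "H \<noteq> {}" and s: "\<And>i. i \<in> H \<Longrightarrow> s i \<in> K"
    and mixK: "\<And>p q u. p \<in> K \<Longrightarrow> q \<in> K \<Longrightarrow> u \<in> {0..1} \<Longrightarrow> mix u p q \<in> K"
  shows "\<exists>e. measurement K H e \<and> opt_success K s H = (\<Sum>i\<in>H. e i (s i))"
    and "measurement K H f \<Longrightarrow> (\<Sum>i\<in>H. f i (s i)) \<le> opt_success K s H"
proof -
  \<comment> \<open>Values outside \<open>H\<close> and \<open>K\<close> are not constrained by
    \<open>measurement\<close>; pinning them to 0 keeps every factor compact.\<close>
  define Box :: "(nat \<Rightarrow> (nat \<Rightarrow> real) \<Rightarrow> real) set" where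
    "Box = PiE UNIV (\<lambda>i. PiE UNIV (\<lambda>x. if i \<in> H \<and> x \<in> K then {0..1} else {0}))"
  define A where "A = {e :: nat \<Rightarrow> (nat \<Rightarrow> real) \<Rightarrow> real. \<forall>x\<in>H. \<forall>p\<in>K. \<forall>q\<in>K. \<forall>u\<in>{0..1}.
      e x (mix u p q) = (1 - u) * e x p + u * e x q}"
  define N where "N = {e :: nat \<Rightarrow> (nat \<Rightarrow> real) \<Rightarrow> real. \<forall>p\<in>K. (\<Sum>x\<in>H. e x p) = 1}"
  define val where "val = (\<lambda>e :: nat \<Rightarrow> (nat \<Rightarrow> real) \<Rightarrow> real. \<Sum>i\<in>H. e i (s i))"
  have coord: "continuous_on UNIV (\<lambda>e :: nat \<Rightarrow> (nat \<Rightarrow> real) \<Rightarrow> real. e x p)" for x p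
  proof -
    have "continuous_on UNIV (\<lambda>e :: nat \<Rightarrow> (nat \<Rightarrow> real) \<Rightarrow> real. e x)" by simp
    from continuous_on_product_then_coordinatewise[OF this] show ?thesis .
  qed
  have "compact Box"
    unfolding Box_def by (intro compact_PiE_UNIV) auto
  moreover have "closed A"
    unfolding A_def by (intro closed_Collect_ball closed_Collect_eq continuous_intros coord)
  moreover have "closed N"
    unfolding N_def by (intro closed_Collect_ball closed_Collect_eq continuous_intros coord)
  ultimately have cZ: "compact (Box \<inter> A \<inter> N)"
    by (intro compact_Int_closed)
  have meas: "measurement K H e" if "e \<in> Box \<inter> A \<inter> N" for e
    using that H(1) unfolding Box_def A_def N_def measurement_def affine_fun_on_def
    by (force simp: PiE_iff split: if_splits)
  \<comment> \<open>Nonnegative effects summing to 1 are at most 1, so a truncated measurement lands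
    in the box; affinity survives truncation because mixtures stay in \<open>K\<close>.\<close>
  have restr: "(\<lambda>i x. if i \<in> H \<and> x \<in> K then e i x else 0) \<in> Box \<inter> A \<inter> N"
    if "measurement K H e" for e
  proof -
    have "e i x \<le> 1" if "i \<in> H" "x \<in> K" for i x
      using member_le_sum[of i H "\<lambda>i. e i x"] that \<open>measurement K H e\<close>
      by (auto simp: measurement_def)
    then show ?thesis
      using that mixK by (auto simp: Box_def A_def N_def measurement_def affine_fun_on_def)
  qed
  have val_restr: "val (\<lambda>i x. if i \<in> H \<and> x \<in> K then e i x else 0) = val e" for e
    unfolding val_def by (intro sum.cong) (auto simp: s)
  obtain a where a: "a \<in> H" using H by blast
  have "measurement K H (\<lambda>i x. if i = a then 1 else 0)"
    using H(1) a by (auto simp: measurement_def affine_fun_on_def)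
  then have "Box \<inter> A \<inter> N \<noteq> {}" using restr by blast
  moreover have "continuous_on (Box \<inter> A \<inter> N) val"
    unfolding val_def by (intro continuous_intros continuous_on_subset[OF coord]) auto
  ultimately obtain e where e: "e \<in> Box \<inter> A \<inter> N" "\<And>g. g \<in> Box \<inter> A \<inter> N \<Longrightarrow> val g \<le> val e"
    using continuous_attains_sup[OF cZ] by blast
  have ub: "val g \<le> val e" if "measurement K H g" for g
    using e(2)[OF restr[OF that]] val_restr by simp
  have "opt_success K s H = val e"
    unfolding opt_success_def using H(2) meas[OF e(1)] ub
    by (auto simp: val_def intro!: Greatest_equality)
  then show "\<exists>e. measurement K H e \<and> opt_success K s H = (\<Sum>i\<in>H. e i (s i))"
    and "measurement K H f \<Longrightarrow> (\<Sum>i\<in>H. f i (s i)) \<le> opt_success K s H"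
    using meas[OF e(1)] ub unfolding val_def by auto
qed

text \<open>Post-processing: on outcome \<open>x\<close> guess an index \<open>h x\<close> in
  \<open>G\<close> that maximizes \<open>e x (s i)\<close>. Merging the outcomes with equal guess
  gives a measurement indexed by \<open>G\<close> with exactly this success.\<close>

lemma sum_Max_le_opt_success:
  assumes e: "measurement K H e"
    and G: "finite G" "G \<noteq> {}" and s: "\<And>i. i \<in> G \<Longrightarrow> s i \<in> K"
    and mixK: "\<And>p q u. p \<in> K \<Longrightarrow> q \<in> K \<Longrightarrow> u \<in> {0..1} \<Longrightarrow> mix u p q \<in> K"
  shows "(\<Sum>x\<in>H. Max ((\<lambda>i. e x (s i)) ` G)) \<le> opt_success K s G"
proof -
  have finH: "finite H" using e by (simp add: measurement_def)
  have "\<exists>i\<in>G. e x (s i) = Max ((\<lambda>i. e x (s i)) ` G)" for x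
    by (rule obtains_MAX[OF G, of "\<lambda>i. e x (s i)"]) (rule bexI, rule sym)
  then obtain h where h: "\<And>x. h x \<in> G" "\<And>x. e x (s (h x)) = Max ((\<lambda>i. e x (s i)) ` G)"
    by (metis (no_types))
  define f where "f = (\<lambda>i p. \<Sum>x\<in>{x \<in> H. h x = i}. e x p)"
  have "measurement K G f"
    unfolding measurement_def
  proof (intro conjI ballI)
    show "affine_fun_on K (f i)" for i
      unfolding f_def affine_fun_on_def sum_distrib_left sum.distrib[symmetric]
      using e by (intro ballI sum.cong) (auto simp: measurement_def affine_fun_on_def)
    show "0 \<le> f i p" if "p \<in> K" for i p
      using e that unfolding f_def by (intro sum_nonneg) (auto simp: measurement_def)
    show "(\<Sum>i\<in>G. f i p) = 1" if "p \<in> K" for p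
      unfolding f_def using e that G(1) finH h(1)
      by (subst sum.group) (auto simp: measurement_def)
  qed (fact G)
  then have "(\<Sum>i\<in>G. f i (s i)) \<le> opt_success K s G"
    using opt_success_attained(2) G s mixK by blast
  moreover have "(\<Sum>i\<in>G. f i (s i)) = (\<Sum>x\<in>H. e x (s (h x)))"
    unfolding f_def using sum.group[OF finH G(1), of h "\<lambda>x. e x (s (h x))"] h(1)
    by (subst sum.group[OF finH G(1), of h "\<lambda>x. e x (s (h x))", symmetric]) (auto intro!: sum.cong)
  ultimately show ?thesis by (simp add: h(2))
qed

text \<open>A level set \<open>{i. a i \<ge> t}\<close> with \<open>t > 0\<close> meets
  \<open>G\<close> exactly when \<open>t\<close> is at most the maximum of \<open>a\<close> on
  \<open>G\<close>. The induction peels off one level at a time: the smallest positive value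
  \<open>m\<close> becomes the weight of the support \<open>S\<close> and is subtracted
  there.\<close>

lemma layer_cake:
  fixes a :: "'a \<Rightarrow> real"
  assumes "finite A" "\<And>i. i \<in> A \<Longrightarrow> 0 \<le> a i"
  shows "\<exists>c. (\<forall>B. 0 \<le> c B) \<and>
    (\<forall>G\<subseteq>A. G \<noteq> {} \<longrightarrow> (\<Sum>B\<in>{B. B \<subseteq> A \<and> B \<inter> G \<noteq> {}}. c B) = Max (a ` G))"
  using assms
proof (induction "card {i \<in> A. 0 < a i}" arbitrary: a rule: less_induct)
  case less
  define S where "S = {i \<in> A. 0 < a i}"
  have S: "finite S" "S \<subseteq> A" using less.prems(1) by (auto simp: S_def)
  show ?case
  proof (cases "S = {}")
    case True
    have "a ` G = {0}" if "G \<subseteq> A" "G \<noteq> {}" for G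
    proof -
      have "a i = 0" if "i \<in> G" for i
        using less.prems(2)[of i] True that \<open>G \<subseteq> A\<close> by (force simp: S_def)
      then show ?thesis using that by auto
    qed
    then show ?thesis by (intro exI[of _ "\<lambda>_. 0"]) auto
  next
    case False
    define m where "m = Min (a ` S)"
    define b where "b = (\<lambda>i. if i \<in> S then a i - m else a i)"
    obtain k where k: "k \<in> S" "m = a k"
      unfolding m_def by (rule obtains_MIN[OF S(1) False, of a])
    have m: "m \<le> a i" if "i \<in> S" for i using that S by (auto simp: m_def)
    have "m > 0" using k by (auto simp: S_def)
    \<comment> \<open>The index \<open>k\<close> attaining the minimum drops to 0, so the support
      shrinks strictly.\<close>
    have "{i \<in> A. 0 < b i} \<subset> S"
      using k \<open>m > 0\<close> by (auto simp: b_def S_def)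
    then have lt: "card {i \<in> A. 0 < b i} < card S" using S by (simp add: psubset_card_mono)
    have "0 \<le> b i" if "i \<in> A" for i
      using m less.prems(2) that by (simp add: b_def)
    with less.hyps[OF lt[unfolded S_def] less.prems(1)]
    have "\<exists>c. (\<forall>B. 0 \<le> c B) \<and> (\<forall>G\<subseteq>A. G \<noteq> {} \<longrightarrow>
      (\<Sum>B\<in>{B. B \<subseteq> A \<and> B \<inter> G \<noteq> {}}. c B) = Max (b ` G))" .
    then obtain c where c': "(\<forall>B. 0 \<le> c B) \<and> (\<forall>G\<subseteq>A. G \<noteq> {} \<longrightarrow>
      (\<Sum>B\<in>{B. B \<subseteq> A \<and> B \<inter> G \<noteq> {}}. c B) = Max (b ` G))"
      by (elim exE)
    have c: "\<And>B. 0 \<le> c B"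
      "\<And>G. G \<subseteq> A \<Longrightarrow> G \<noteq> {} \<Longrightarrow> (\<Sum>B\<in>{B. B \<subseteq> A \<and> B \<inter> G \<noteq> {}}. c B) = Max (b ` G)"
      using c' by simp_all
    have eq: "(\<Sum>B\<in>{B. B \<subseteq> A \<and> B \<inter> G \<noteq> {}}. c B + (if B = S then m else 0)) = Max (a ` G)"
      if G: "G \<subseteq> A" "G \<noteq> {}" for G
    proof -
      have fG: "finite G" using G less.prems(1) finite_subset by blast
      have fB: "finite {B. B \<subseteq> A \<and> B \<inter> G \<noteq> {}}" using less.prems(1) by simp
      have "(\<Sum>B\<in>{B. B \<subseteq> A \<and> B \<inter> G \<noteq> {}}. c B + (if B = S then m else 0))
          = Max (b ` G) + (if S \<inter> G \<noteq> {} then m else 0)"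
        using c(2)[OF G] fB S by (simp add: sum.distrib)
      also have "\<dots> = Max (a ` G)"
      proof (cases "S \<inter> G = {}")
        case True
        then have "b ` G = a ` G" by (intro image_cong) (auto simp: b_def)
        then show ?thesis using True by simp
      next
        case False
        obtain j where j: "j \<in> G" "Max (b ` G) = b j"
          by (rule obtains_MAX[OF fG G(2), of b])
        obtain i where i: "i \<in> S" "i \<in> G" using False by blast
        have bub: "b i' \<le> b j" if "i' \<in> G" for i'
          unfolding j(2)[symmetric] using that fG by simp
        have neg: "a i' \<le> 0" if "i' \<in> G" "i' \<notin> S" for i' using that G by (auto simp: S_def)
        \<comment> \<open>If the maximizer \<open>j\<close> of \<open>b\<close> lies outside
          \<open>S\<close>, then \<open>b j \<le> 0\<close>, while \<open>b i \<ge> 0\<close>; this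
          forces \<open>b i = b j = 0\<close> and \<open>a i = m\<close>, so \<open>i\<close> serves
          instead.\<close>
        have "\<exists>j'\<in>G. b j + m = a j'"
        proof (cases "j \<in> S")
          case True
          then have "b j + m = a j" by (simp add: b_def)
          then show ?thesis using j(1) by blast
        next
          case False
          have "b i \<le> b j" using bub i by blast
          moreover have "b j \<le> 0" using False neg[OF j(1)] by (simp add: b_def)
          moreover have "b i = a i - m" "a i \<ge> m" using i m by (auto simp: b_def)
          ultimately show ?thesis using i by force
        qed
        moreover have "a i' \<le> b j + m" if "i' \<in> G" for i'
        proof (cases "i' \<in> S")
          case True then show ?thesis using bub[OF that] by (simp add: b_def)
        next
          case False
          then show ?thesis using neg[OF that] bub[OF i(2)] m[OF i(1)] i \<open>m > 0\<close>
            by (simp add: b_def)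
        qed
        ultimately have "Max (a ` G) = b j + m"
          using fG by (intro Max_eqI) (auto simp: image_iff)
        then show ?thesis using False j by auto
      qed
      finally show ?thesis .
    qed
    show ?thesis
      using c(1) \<open>m > 0\<close> eq
      by (intro exI[of _ "\<lambda>B. c B + (if B = S then m else 0)"]) (simp add: add_nonneg_nonneg)
  qed
qed

text \<open>Supplies a \<open>theta\<close> that touches the optimal success at \<open>H\<close> and
  stays below it elsewhere, so that a maximum over such functions reproduces it.\<close>

lemma theta_representation_of_optimum:
  assumes HG: "H \<subseteq> {1..n}" "H \<noteq> {}"
    and s: "\<And>i. i \<in> {1..n} \<Longrightarrow> s i \<in> K"
    and mixK: "\<And>p q u. p \<in> K \<Longrightarrow> q \<in> K \<Longrightarrow> u \<in> {0..1} \<Longrightarrow> mix u p q \<in> K"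
  shows "\<exists>c\<in>coeff_polytope n. theta n c H = opt_success K s H \<and>
    (\<forall>G\<subseteq>{1..n}. theta n c G \<le> opt_success K s G)"
proof -
  have finH: "finite H" using HG finite_subset by blast
  obtain e where e: "measurement K H e" "opt_success K s H = (\<Sum>i\<in>H. e i (s i))"
    using opt_success_attained(1)[OF finH HG(2), of s K] s mixK HG by blast
  have "\<forall>x\<in>H. \<exists>c. (\<forall>B. 0 \<le> c B) \<and>
    (\<forall>G\<subseteq>{1..n}. G \<noteq> {} \<longrightarrow> (\<Sum>B\<in>{B. B \<subseteq> {1..n} \<and> B \<inter> G \<noteq> {}}. c B) = Max ((\<lambda>i. e x (s i)) ` G))"
    using e(1) s by (intro ballI layer_cake) (auto simp: measurement_def)
  from bchoice[OF this] obtain c where c': "\<forall>x\<in>H. (\<forall>B. 0 \<le> c x B) \<and>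
    (\<forall>G\<subseteq>{1..n}. G \<noteq> {} \<longrightarrow>
      (\<Sum>B\<in>{B. B \<subseteq> {1..n} \<and> B \<inter> G \<noteq> {}}. c x B) = Max ((\<lambda>i. e x (s i)) ` G))"
    by (elim exE)
  have c: "\<And>x B. x \<in> H \<Longrightarrow> 0 \<le> c x B"
    "\<And>x G. x \<in> H \<Longrightarrow> G \<subseteq> {1..n} \<Longrightarrow> G \<noteq> {} \<Longrightarrow>
      (\<Sum>B\<in>{B. B \<subseteq> {1..n} \<and> B \<inter> G \<noteq> {}}. c x B) = Max ((\<lambda>i. e x (s i)) ` G)"
    using c' by simp_all
  \<comment> \<open>\<open>restrict\<close> meets the extensionality demanded by
    \<open>coeff_polytope\<close>. The value at the empty set becomes \<open>undefined\<close>, but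
    \<open>theta\<close> sums only over nonempty \<open>B\<close>.\<close>
  define C where "C = restrict (\<lambda>B. \<Sum>x\<in>H. c x B) (Pow {1..n} - {{}})"
  have th: "theta n C G = (\<Sum>x\<in>H. Max ((\<lambda>i. e x (s i)) ` G))" if G: "G \<subseteq> {1..n}" "G \<noteq> {}" for G
  proof -
    have "theta n C G = (\<Sum>B\<in>{B. B \<subseteq> {1..n} \<and> B \<inter> G \<noteq> {}}. \<Sum>x\<in>H. c x B)"
      unfolding theta_def by (intro sum.cong) (auto simp: C_def)
    also have "\<dots> = (\<Sum>x\<in>H. \<Sum>B\<in>{B. B \<subseteq> {1..n} \<and> B \<inter> G \<noteq> {}}. c x B)" by (rule sum.swap)
    finally show ?thesis using c(2) G by simp
  qed
  \<comment> \<open>The constraint of the polytope at \<open>i\<close> is \<open>theta\<close> at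
    \<open>{i}\<close>, where the maxima reduce to \<open>e x (s i)\<close> and normalization
    applies.\<close>
  have "(\<Sum>B\<in>{B. B \<subseteq> {1..n} \<and> i \<in> B}. C B) = 1" if "i \<in> {1..n}" for i
    using th[of "{i}"] e(1) s that by (simp add: theta_def measurement_def)
  then have "C \<in> coeff_polytope n"
    using c(1) by (auto simp: coeff_polytope_def C_def intro!: sum_nonneg)
  moreover have le: "theta n C G \<le> opt_success K s G" if "G \<subseteq> {1..n}" for G
  proof (cases "G = {}")
    case True then show ?thesis by (simp add: theta_def opt_success_def)
  next
    case False
    then have "(\<Sum>x\<in>H. Max ((\<lambda>i. e x (s i)) ` G)) \<le> opt_success K s G"
      using that s mixK finite_subset[OF that]
      by (intro sum_Max_le_opt_success[OF e(1)]) auto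
    then show ?thesis using th that False by simp
  qed
  \<comment> \<open>Guessing \<open>i\<close> on outcome \<open>i\<close> is one of the
    post-processings over which the maxima are taken.\<close>
  moreover have "opt_success K s H \<le> theta n C H"
    unfolding e(2) th[OF HG] using finH by (intro sum_mono) auto
  ultimately show ?thesis using HG by (intro bexI[of _ C] conjI antisym) auto
qed

section \<open>Discrimination in products of simplexes\<close>

lemma affine_fun_on_convex_combination:
  assumes f: "affine_fun_on K f"
    and mixK: "\<And>p q u. p \<in> K \<Longrightarrow> q \<in> K \<Longrightarrow> u \<in> {0..1} \<Longrightarrow> mix u p q \<in> K"
    and "finite I" "\<And>i. i \<in> I \<Longrightarrow> z i \<in> K" "\<And>i. i \<in> I \<Longrightarrow> 0 \<le> u i" "sum u I = 1"
  shows "(\<lambda>l. \<Sum>i\<in>I. u i * z i l) \<in> K \<and> f (\<lambda>l. \<Sum>i\<in>I. u i * z i l) = (\<Sum>i\<in>I. u i * f (z i))"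
  using assms(3-)
proof (induction I arbitrary: u rule: finite_induct)
  case empty
  then show ?case by simp
next
  case (insert a I)
  have nn: "0 \<le> u i" if "i \<in> I" for i using insert.prems(2) that by simp
  have s: "u a + sum u I = 1" using insert by simp
  show ?case
  \<comment> \<open>The induction splits off \<open>a\<close> and rescales the other weights by
    \<open>1 - u a\<close>. When this factor is 0, those weights all vanish.\<close>
  proof (cases "u a = 1")
    case True
    then have "sum u I = 0" using s by simp
    then have "u i = 0" if "i \<in> I" for i
      using sum_nonneg_eq_0_iff[of I u] insert.hyps nn that by auto
    then show ?thesis using insert True by simp
  next
    case False
    define v where "v = (\<lambda>i. u i / (1 - u a))"
    have ua: "0 \<le> u a" "u a < 1"
      using False s sum_nonneg[of I u] nn insert.prems(2)[of a] by auto
    have "sum v I = 1" unfolding v_def sum_divide_distrib[symmetric] using s ua by simp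
    then have IH: "(\<lambda>l. \<Sum>i\<in>I. v i * z i l) \<in> K"
      "f (\<lambda>l. \<Sum>i\<in>I. v i * z i l) = (\<Sum>i\<in>I. v i * f (z i))"
      using insert.IH[of v] insert.prems(1) nn ua by (auto simp: v_def)
    have uv: "(\<Sum>i\<in>I. u i * h i) = (1 - u a) * (\<Sum>i\<in>I. v i * h i)" for h :: "_ \<Rightarrow> real"
      unfolding sum_distrib_left v_def using ua by (intro sum.cong) auto
    have eq: "(\<lambda>l. \<Sum>i\<in>insert a I. u i * z i l) = mix (u a) (\<lambda>l. \<Sum>i\<in>I. v i * z i l) (z a)"
      unfolding mix_def using insert.hyps by (simp add: uv add.commute)
    show ?thesis
      unfolding eq using IH f ua insert.prems(1)[of a] insert.hyps mixK
      by (auto simp: affine_fun_on_def uv)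
  qed
qed

section \<open>Coordinates, vertices and compactness of powers of a simplex\<close>

abbreviation simplex_power :: "nat \<Rightarrow> nat \<Rightarrow> (nat \<Rightarrow> real) set" where
  "simplex_power r M \<equiv> simplex_product (replicate r M)"

lemma block_index_less: "k < r \<Longrightarrow> j < M \<Longrightarrow> k * M + j < r * (M::nat)"
proof -
  assume "k < r" "j < M"
  then have "k * M + j < Suc k * M" by simp
  also have "\<dots> \<le> r * M" using \<open>k < r\<close> by (intro mult_le_mono1) simp
  finally show ?thesis .
qed

text \<open>Equal factor sizes put coordinate \<open>j\<close> of component \<open>k\<close> at the
  explicit index \<open>k * M + j\<close>, which replaces the partial sums in
  \<open>block\<close>.\<close>

lemma simplex_power_iff:
  "x \<in> simplex_power r M \<longleftrightarrow> (\<forall>l\<ge>r * M. x l = 0) \<and>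
    (\<forall>k<r. (\<forall>j<M. 0 \<le> x (k * M + j)) \<and> (\<Sum>j<M. x (k * M + j)) = 1)"
  by (auto simp: simplex_product_def prob_simplex_def block_def topspace_Euclidean_space
      sum_list_replicate min_def)

lemma simplex_power_mix:
  assumes "p \<in> simplex_power r M" "q \<in> simplex_power r M" "u \<in> {0..1}"
  shows "mix u p q \<in> simplex_power r M"
  using assms unfolding simplex_power_iff mix_def
  by (auto simp: sum.distrib sum_distrib_left[symmetric])

text \<open>An extreme point of the product: \<open>v\<close> selects one simplex vertex in each
  component.\<close>

definition power_vertex :: "nat \<Rightarrow> nat \<Rightarrow> (nat \<Rightarrow> nat) \<Rightarrow> nat \<Rightarrow> real" where
  "power_vertex r M v = (\<lambda>l. if l < r * M \<and> l mod M = v (l div M) then 1 else 0)"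

lemma power_vertex_block:
  "k < r \<Longrightarrow> j < M \<Longrightarrow> power_vertex r M v (k * M + j) = (if j = v k then 1 else 0)"
  by (simp add: power_vertex_def block_index_less)

lemma power_vertex_in:
  assumes "\<And>k. k < r \<Longrightarrow> v k < M"
  shows "power_vertex r M v \<in> simplex_power r M"
  unfolding simplex_power_iff
  using assms by (auto simp: power_vertex_block) (simp add: power_vertex_def)

lemma gpt_state_space_simplex_power:
  assumes "1 \<le> r" "1 \<le> M"
  shows "gpt_state_space (sum_list (replicate r M)) (simplex_power r M)"
proof -
  define Z where "Z = PiE UNIV (\<lambda>l. if l < r * M then {0..1::real} else {0})"
  define S where "S = {x :: nat \<Rightarrow> real. \<forall>k\<in>{..<r}. (\<Sum>j<M. x (k * M + j)) = 1}"
  \<comment> \<open>For compactness the power is written as a box cut by closed block-sum equations;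
    a coordinate is at most its block sum 1.\<close>
  have "x \<in> simplex_power r M \<longleftrightarrow> x \<in> Z \<inter> S" for x
  proof
    assume x: "x \<in> simplex_power r M"
    have "x l \<in> {0..1}" if "l < r * M" for l
    proof -
      have "l div M < r" "l mod M < M" using that assms by (simp_all add: less_mult_imp_div_less)
      moreover have "x (l div M * M + l mod M) \<le> (\<Sum>j<M. x (l div M * M + j))"
        using x calculation by (intro member_le_sum[of "l mod M" "{..<M}" "\<lambda>j. x (l div M * M + j)"])
          (auto simp: simplex_power_iff)
      moreover have "(\<Sum>j<M. x (l div M * M + j)) = 1" "0 \<le> x (l div M * M + l mod M)"
        using x calculation(1,2) unfolding simplex_power_iff by blast+
      ultimately show ?thesis by simp
    qed
    then show "x \<in> Z \<inter> S" using x by (auto simp: Z_def S_def simplex_power_iff)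
  next
    assume "x \<in> Z \<inter> S"
    then have Z: "x l \<in> (if l < r * M then {0..1} else {0})" and "x \<in> S" for l
      unfolding Z_def by (blast intro: PiE_mem)+
    then show "x \<in> simplex_power r M"
      unfolding simplex_power_iff
    proof (intro conjI allI impI)
      show "x l = 0" if "r * M \<le> l" for l using Z[of l] that by simp
      show "0 \<le> x (k * M + j)" if "k < r" "j < M" for k j
        using Z[of "k * M + j"] block_index_less[OF that] by simp
    qed (simp add: S_def)
  qed
  then have eq: "simplex_power r M = Z \<inter> S" by blast
  have "compact Z" unfolding Z_def by (intro compact_PiE_UNIV) auto
  moreover have "closed S"
    unfolding S_def by (intro closed_Collect_ball closed_Collect_eq continuous_intros) auto
  ultimately have "compact (simplex_power r M)" unfolding eq by (intro compact_Int_closed)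
  then have "compactin (Euclidean_space (r * M)) (simplex_power r M)"
    by (auto simp: Euclidean_space_def compactin_subtopology euclidean_product_topology simplex_power_iff)
  moreover have "power_vertex r M (\<lambda>_. 0) \<in> simplex_power r M"
    using assms by (intro power_vertex_in) auto
  moreover have "1 \<le> r * M" using assms by (metis mult_le_mono nat_mult_1)
  ultimately show ?thesis
    unfolding gpt_state_space_def using simplex_power_mix
    by (auto simp: sum_list_replicate)
qed

text \<open>
  With \<open>z k j\<close> the vertex that is \<open>j\<close> in component \<open>k\<close> and \<open>0\<close> elsewhere, and \<open>q\<close> the vertex \<open>0\<close>, the
  combination of the \<open>z k j\<close> with weights \<open>x\<^bsub>k j\<^esub> / r\<close> is \<open>(1 - 1/r) q + (1/r) x\<close>. The constant
  term is absorbed into the coefficients because each component sums to \<open>1\<close>.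
\<close>

lemma affine_fun_on_simplex_power:
  assumes "1 \<le> r" "1 \<le> M" and f: "affine_fun_on (simplex_power r M) f"
  shows "\<exists>g. \<forall>x\<in>simplex_power r M. f x = (\<Sum>k<r. \<Sum>j<M. g k j * x (k * M + j))"
proof -
  define q where "q = power_vertex r M (\<lambda>_. 0)"
  define z where "z = (\<lambda>k j. power_vertex r M ((\<lambda>_. 0)(k := j)))"
  define g where "g = (\<lambda>k j. f (z k j) - (1 - 1 / r) * f q)"
  have qK: "q \<in> simplex_power r M" unfolding q_def using assms by (intro power_vertex_in) auto
  have zK: "z k j \<in> simplex_power r M" if "j < M" for k j
    unfolding z_def using assms that by (intro power_vertex_in) auto
  have "f x = (\<Sum>k<r. \<Sum>j<M. g k j * x (k * M + j))" if x: "x \<in> simplex_power r M" for x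
  proof -
    have one: "(\<Sum>j<M. x (k * M + j)) = 1" if "k < r" for k
      using x that by (simp add: simplex_power_iff)
    have sum_r: "(\<Sum>k<r. \<Sum>j<M. x (k * M + j)) = r" using one by simp
    have eq: "(\<lambda>l. \<Sum>p\<in>{..<r} \<times> {..<M}. x (fst p * M + snd p) / r * z (fst p) (snd p) l) = mix (1 / r) q x"
    proof
      fix l
      have "(\<Sum>p\<in>{..<r} \<times> {..<M}. x (fst p * M + snd p) / r * z (fst p) (snd p) l)
          = (\<Sum>k<r. \<Sum>j<M. x (k * M + j) * z k j l) / r"
        by (simp add: sum.cartesian_product split_def sum_divide_distrib)
      also have "\<dots> = mix (1 / r) q x l"
      proof (cases "l < r * M")
        case False
        then show ?thesis using x by (simp add: z_def q_def power_vertex_def mix_def simplex_power_iff)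
      next
        case True
        define k' j' where "k' = l div M" and "j' = l mod M"
        have k': "k' < r" "j' < M" "l = k' * M + j'"
          using True assms by (simp_all add: k'_def j'_def less_mult_imp_div_less)
        \<comment> \<open>In block \<open>k\<close> the vertices \<open>z k j\<close> reproduce
          \<open>x\<close>; in every other block they agree with \<open>q\<close>, and the weights
          add up to 1. Over all \<open>k\<close> this gives
          \<open>x l + (r - 1) * q l\<close>.\<close>
        have "(\<Sum>j<M. x (k * M + j) * z k j l) = (if k = k' then x l else q l)" if "k < r" for k
        proof (cases "k = k'")
          case True
          then have "(\<Sum>j<M. x (k * M + j) * z k j l) = (\<Sum>j<M. if j = j' then x (k * M + j) else 0)"
            using k' by (intro sum.cong) (auto simp: z_def power_vertex_block)
          then show ?thesis using k' True by simp
        next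
          case False
          then have "(\<Sum>j<M. x (k * M + j) * z k j l) = (\<Sum>j<M. x (k * M + j) * q l)"
            using k' by (intro sum.cong) (auto simp: z_def q_def power_vertex_block)
          then show ?thesis using False one[OF that] by (simp add: sum_distrib_right[symmetric])
        qed
        then have "(\<Sum>k<r. \<Sum>j<M. x (k * M + j) * z k j l) = (\<Sum>k<r. if k = k' then x l else q l)"
          by (intro sum.cong) auto
        also have "\<dots> = x l + (\<Sum>k\<in>{..<r} - {k'}. q l)"
          using k'(1) by (subst sum.remove[of _ k']) auto
        also have "\<dots> = x l + (real r - 1) * q l"
          using k'(1) by (simp add: of_nat_diff)
        finally show ?thesis using assms(1) by (simp add: mix_def field_simps)
      qed
      finally show "(\<Sum>p\<in>{..<r} \<times> {..<M}. x (fst p * M + snd p) / r * z (fst p) (snd p) l)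
        = mix (1 / r) q x l" .
    qed
    have "f (mix (1 / r) q x) = (\<Sum>p\<in>{..<r} \<times> {..<M}. x (fst p * M + snd p) / r * f (z (fst p) (snd p)))"
      unfolding eq[symmetric]
    proof (rule conjunct2[OF affine_fun_on_convex_combination[OF f simplex_power_mix]])
      show "(\<Sum>p\<in>{..<r} \<times> {..<M}. x (fst p * M + snd p) / r) = 1"
        using sum_r assms(1)
        by (simp add: sum_divide_distrib[symmetric] sum.cartesian_product split_def)
    qed (use x zK in \<open>auto simp: simplex_power_iff\<close>)
    also have "\<dots> = (\<Sum>k<r. \<Sum>j<M. x (k * M + j) * f (z k j)) / r"
      by (simp add: sum.cartesian_product split_def sum_divide_distrib)
    finally have "(1 - 1 / r) * f q + (1 / r) * f x = (\<Sum>k<r. \<Sum>j<M. x (k * M + j) * f (z k j)) / r"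
      using f qK x assms(1) by (simp add: affine_fun_on_def)
    then have "r * ((1 - 1 / r) * f q + (1 / r) * f x) = (\<Sum>k<r. \<Sum>j<M. x (k * M + j) * f (z k j))"
      using assms(1) by simp
    then have "f x = (\<Sum>k<r. \<Sum>j<M. x (k * M + j) * f (z k j)) - r * ((1 - 1 / r) * f q)"
      using assms(1) by (simp add: distrib_left)
    also have "\<dots> = (\<Sum>k<r. \<Sum>j<M. x (k * M + j) * f (z k j))
        - (\<Sum>k<r. \<Sum>j<M. x (k * M + j)) * ((1 - 1 / r) * f q)"
      by (simp only: sum_r)
    also have "\<dots> = (\<Sum>k<r. \<Sum>j<M. g k j * x (k * M + j))"
      unfolding sum_distrib_right sum_subtractf[symmetric]
      by (intro sum.cong refl) (simp add: g_def algebra_simps)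
    finally show ?thesis .
  qed
  then show ?thesis by blast
qed

text \<open>
  Subtracting from the coefficients of each effect their minimum over every component leaves
  nonnegative coefficients; the subtracted total is the value of the effect at a vertex, hence
  nonnegative too.
\<close>

lemma measurement_simplex_power_le:
  assumes r: "1 \<le> r" "1 \<le> M" and e: "measurement (simplex_power r M) H e"
    and H: "H \<noteq> {}" and s: "\<And>i. i \<in> H \<Longrightarrow> s i \<in> simplex_power r M"
    and T: "\<And>k. k < r \<Longrightarrow> (\<Sum>j<M. Max ((\<lambda>i. s i (k * M + j)) ` H)) \<le> T"
  shows "(\<Sum>i\<in>H. e i (s i)) \<le> T"
proof -
  let ?K = "simplex_power r M"
  define y where "y = (\<lambda>k j. Max ((\<lambda>i. s i (k * M + j)) ` H))"
  have finH: "finite H" using e by (simp add: measurement_def)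
  have "\<forall>i\<in>H. \<exists>g. \<forall>x\<in>?K. e i x = (\<Sum>k<r. \<Sum>j<M. g k j * x (k * M + j))"
    using e r by (intro ballI affine_fun_on_simplex_power) (auto simp: measurement_def)
  from bchoice[OF this] obtain g where g: "\<And>i x. i \<in> H \<Longrightarrow> x \<in> ?K \<Longrightarrow>
      e i x = (\<Sum>k<r. \<Sum>j<M. g i k j * x (k * M + j))"
    by blast
  have "\<exists>j<M. \<forall>j'<M. g i k j \<le> g i k j'" for i k
    using ex_min_if_finite[of "g i k ` {..<M}"] r(2)
    by (auto simp: not_less lessThan_empty_iff)
  then obtain v where v: "\<And>i k. v i k < M" "\<And>i k j. j < M \<Longrightarrow> g i k (v i k) \<le> g i k j"
    by metis
  have vertex: "e i (power_vertex r M w) = (\<Sum>k<r. g i k (w k))"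
    if "i \<in> H" "\<And>k. k < r \<Longrightarrow> w k < M" for i w
  proof -
    have "power_vertex r M w \<in> ?K" using that(2) by (rule power_vertex_in)
    then have "e i (power_vertex r M w) = (\<Sum>k<r. \<Sum>j<M. if j = w k then g i k j else 0)"
      unfolding g[OF that(1) \<open>power_vertex r M w \<in> ?K\<close>]
      by (intro sum.cong refl) (simp add: power_vertex_block)
    then show ?thesis using that(2) by simp
  qed
  \<comment> \<open>\<open>\<Lambda> k 0 - \<mu> k\<close> acts as the probability of measuring
    component \<open>k\<close>, and \<open>sum \<mu> {..<r}\<close> as that of guessing without
    measuring. A single \<open>\<mu> k\<close> may be negative; only the sum is shown
    nonnegative.\<close>
  define m where "m = (\<lambda>i k. g i k (v i k))"
  define \<mu> where "\<mu> = (\<lambda>k. \<Sum>i\<in>H. m i k)"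
  define \<Lambda> where "\<Lambda> = (\<lambda>k j. \<Sum>i\<in>H. g i k j)"
  have m_le: "m i k \<le> g i k j" if "j < M" for i k j using v that by (simp add: m_def)
  have \<mu>_nonneg: "0 \<le> sum \<mu> {..<r}"
  proof -
    have "sum \<mu> {..<r} = (\<Sum>i\<in>H. \<Sum>k<r. m i k)" unfolding \<mu>_def by (rule sum.swap)
    also have "\<dots> = (\<Sum>i\<in>H. e i (power_vertex r M (v i)))"
      using vertex v(1) by (intro sum.cong) (auto simp: m_def)
    also have "\<dots> \<ge> 0"
      using e power_vertex_in v(1) by (intro sum_nonneg) (auto simp: measurement_def)
    finally show ?thesis .
  qed
  have \<Lambda>_vertex: "(\<Sum>k<r. \<Lambda> k (w k)) = 1" if "\<And>k. k < r \<Longrightarrow> w k < M" for w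
  proof -
    have "(\<Sum>k<r. \<Lambda> k (w k)) = (\<Sum>i\<in>H. e i (power_vertex r M w))"
      unfolding \<Lambda>_def using vertex that by (subst sum.swap) (auto intro!: sum.cong)
    moreover have "power_vertex r M w \<in> ?K" using that by (rule power_vertex_in)
    ultimately show ?thesis using e by (simp add: measurement_def)
  qed
  \<comment> \<open>Moving a vertex within component \<open>k\<close> alone leaves the total 1
    unchanged, so \<open>\<Lambda> k\<close> is constant on the block. This later lets
    \<open>\<Lambda> k j - \<mu> k\<close> be pulled out of the sum over \<open>j\<close>.\<close>
  have \<Lambda>_const: "\<Lambda> k j = \<Lambda> k 0" if "k < r" "j < M" for k j
  proof -
    have "(\<Sum>k'<r. \<Lambda> k' (((\<lambda>_. 0)(k := j)) k')) = (\<Sum>k'<r. \<Lambda> k' 0)"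
      using \<Lambda>_vertex[of "(\<lambda>_. 0)(k := j)"] \<Lambda>_vertex[of "\<lambda>_. 0"] that by auto
    moreover have "(\<Sum>k'\<in>{..<r} - {k}. \<Lambda> k' (((\<lambda>_. 0)(k := j)) k')) = (\<Sum>k'\<in>{..<r} - {k}. \<Lambda> k' 0)"
      by (intro sum.cong) auto
    ultimately show ?thesis
      using that by (simp add: sum.remove[of "{..<r}" k])
  qed
  have \<mu>_le: "\<mu> k \<le> \<Lambda> k 0" for k
    unfolding \<mu>_def \<Lambda>_def using m_le r(2) by (intro sum_mono) auto
  have s1: "(\<Sum>j<M. s i (k * M + j)) = 1" if "i \<in> H" "k < r" for i k
    using s that by (simp add: simplex_power_iff)
  have sy: "s i (k * M + j) \<le> y k j" if "i \<in> H" for i k j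
    unfolding y_def using finH that by simp
  \<comment> \<open>Covers the part that guesses without measuring: its total success
    \<open>sum \<mu> {..<r}\<close> must not exceed \<open>sum \<mu> {..<r} * T\<close>.\<close>
  have T1: "1 \<le> T"
  proof -
    obtain i where i: "i \<in> H" using H by blast
    have "1 = (\<Sum>j<M. s i (0 * M + j))" using s1[OF i, of 0] r by simp
    also have "\<dots> \<le> (\<Sum>j<M. y 0 j)" using sy[OF i, of 0] by (intro sum_mono) simp
    also have "\<dots> \<le> T" using T[of 0] r by (simp add: y_def)
    finally show ?thesis .
  qed
  \<comment> \<open>Only the nonnegative coefficients \<open>g i k j - m i k\<close> allow replacing
    \<open>s i\<close> by the maxima \<open>y\<close>; the constants \<open>m i k\<close> use that a
    block of \<open>s i\<close> sums to 1.\<close>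
  have "e i (s i) \<le> (\<Sum>k<r. m i k + (\<Sum>j<M. (g i k j - m i k) * y k j))" if i: "i \<in> H" for i
  proof -
    have "e i (s i) = (\<Sum>k<r. \<Sum>j<M. m i k * s i (k * M + j) + (g i k j - m i k) * s i (k * M + j))"
      unfolding g[OF i s[OF i]] by (simp add: algebra_simps)
    also have "\<dots> = (\<Sum>k<r. m i k + (\<Sum>j<M. (g i k j - m i k) * s i (k * M + j)))"
      using s1[OF i] by (simp add: sum.distrib sum_distrib_left[symmetric])
    also have "\<dots> \<le> (\<Sum>k<r. m i k + (\<Sum>j<M. (g i k j - m i k) * y k j))"
      using sy[OF i] m_le by (intro sum_mono add_left_mono mult_left_mono) auto
    finally show ?thesis .
  qed
  then have "(\<Sum>i\<in>H. e i (s i)) \<le> (\<Sum>i\<in>H. \<Sum>k<r. m i k + (\<Sum>j<M. (g i k j - m i k) * y k j))"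
    by (rule sum_mono)
  also have "\<dots> = (\<Sum>k<r. \<mu> k + (\<Sum>j<M. (\<Lambda> k j - \<mu> k) * y k j))"
  proof -
    have "(\<Sum>i\<in>H. \<Sum>j<M. (g i k j - m i k) * y k j) = (\<Sum>j<M. (\<Lambda> k j - \<mu> k) * y k j)" for k
      by (subst sum.swap) (simp add: \<Lambda>_def \<mu>_def sum_distrib_right[symmetric] sum_subtractf)
    then show ?thesis
      by (subst sum.swap) (simp add: sum.distrib \<mu>_def)
  qed
  also have "\<dots> = (\<Sum>k<r. \<mu> k + (\<Lambda> k 0 - \<mu> k) * (\<Sum>j<M. y k j))"
  proof (intro sum.cong refl arg_cong2[where f = "(+)"])
    fix k assume "k \<in> {..<r}"
    have "(\<Lambda> k j - \<mu> k) * y k j = (\<Lambda> k 0 - \<mu> k) * y k j" if "j \<in> {..<M}" for j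
    proof -
      have "\<Lambda> k j = \<Lambda> k 0" using \<Lambda>_const \<open>k \<in> {..<r}\<close> that by blast
      then show ?thesis by (simp only:)
    qed
    then show "(\<Sum>j<M. (\<Lambda> k j - \<mu> k) * y k j) = (\<Lambda> k 0 - \<mu> k) * (\<Sum>j<M. y k j)"
      unfolding sum_distrib_left by (rule sum.cong[OF refl])
  qed
  also have "\<dots> \<le> (\<Sum>k<r. \<mu> k + (\<Lambda> k 0 - \<mu> k) * T)"
    using T \<mu>_le by (intro sum_mono add_left_mono mult_left_mono) (auto simp: y_def)
  also have "\<dots> = sum \<mu> {..<r} + (1 - sum \<mu> {..<r}) * T"
    using \<Lambda>_vertex[of "\<lambda>_. 0"] r(2)
    by (simp add: sum.distrib sum_distrib_right[symmetric] sum_subtractf)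
  also have "\<dots> \<le> T"
    using mult_left_mono[OF T1 \<mu>_nonneg] by (simp add: algebra_simps)
  finally show ?thesis .
qed

text \<open>Lower bound: read component \<open>k\<close> and, on result \<open>j\<close>, guess a
  state with the largest weight there. Upper bound: \<open>measurement_simplex_power_le\<close> with
  the maximum over \<open>k\<close> as \<open>T\<close>.\<close>

lemma opt_success_simplex_power:
  assumes r: "1 \<le> r" "1 \<le> M" and H: "finite H" "H \<noteq> {}"
    and s: "\<And>i. i \<in> H \<Longrightarrow> s i \<in> simplex_power r M"
  shows "opt_success (simplex_power r M) s H =
    Max ((\<lambda>k. \<Sum>j<M. Max ((\<lambda>i. s i (k * M + j)) ` H)) ` {..<r})" (is "?opt = Max (?Y ` _)")
proof (rule Max_eqI[symmetric])
  let ?K = "simplex_power r M"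
  have lower: "?Y k \<le> ?opt" if "k < r" for k
  proof -
    have "\<exists>i\<in>H. s i (k * M + j) = Max ((\<lambda>i. s i (k * M + j)) ` H)" for j
      by (rule obtains_MAX[OF H, of "\<lambda>i. s i (k * M + j)"]) (rule bexI, rule sym)
    then obtain h where h: "\<And>j. h j \<in> H" "\<And>j. s (h j) (k * M + j) = Max ((\<lambda>i. s i (k * M + j)) ` H)"
      by (metis (no_types))
    define e where "e = (\<lambda>i (x :: nat \<Rightarrow> real). \<Sum>j\<in>{j \<in> {..<M}. h j = i}. x (k * M + j))"
    have "measurement ?K H e"
      unfolding measurement_def
    proof (intro conjI ballI)
      show "affine_fun_on ?K (e i)" for i
        by (simp add: e_def affine_fun_on_def mix_def sum.distrib sum_distrib_left)
      show "0 \<le> e i x" if "x \<in> ?K" for i x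
        using that \<open>k < r\<close> unfolding e_def simplex_power_iff by (intro sum_nonneg) auto
      show "(\<Sum>i\<in>H. e i x) = 1" if "x \<in> ?K" for x
        unfolding e_def using that \<open>k < r\<close> H h(1)
        by (subst sum.group) (auto simp: simplex_power_iff)
    qed (fact H)
    then have "(\<Sum>i\<in>H. e i (s i)) \<le> ?opt"
      by (intro opt_success_attained(2) H s simplex_power_mix)
    moreover have "(\<Sum>i\<in>H. e i (s i)) = (\<Sum>j<M. s (h j) (k * M + j))"
      unfolding e_def using h(1) H(1)
      by (subst sum.group[of "{..<M}" H h "\<lambda>j. s (h j) (k * M + j)", symmetric])
        (auto intro!: sum.cong)
    ultimately show ?thesis by (simp add: h(2))
  qed
  then show "t \<le> ?opt" if "t \<in> ?Y ` {..<r}" for t using that by blast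
  obtain e where e: "measurement ?K H e" "?opt = (\<Sum>i\<in>H. e i (s i))"
    using opt_success_attained(1)[OF H, of s ?K] s simplex_power_mix by blast
  have Y: "finite (?Y ` {..<r})" "?Y ` {..<r} \<noteq> {}" using r by (auto simp: lessThan_empty_iff)
  then have "?opt \<le> Max (?Y ` {..<r})"
    unfolding e(2) using s by (intro measurement_simplex_power_le[OF r e(1) H(2)]) auto
  moreover have "Max (?Y ` {..<r}) \<le> ?opt" using Y lower by auto
  ultimately show "?opt \<in> ?Y ` {..<r}" using Max_in[OF Y] by (metis order_antisym)
qed (intro finite_imageI finite_lessThan)

section \<open>The characterization of profiles\<close>

text \<open>Source of the bound on \<open>r\<close>: the empty set and the singletons are
  discarded.\<close>

lemma card_subsets_two_elements:
  assumes "finite A"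
  shows "card {H. H \<subseteq> A \<and> 2 \<le> card H} = 2 ^ card A - card A - 1"
proof -
  have "{H. H \<subseteq> A \<and> 2 \<le> card H} = Pow A - insert {} ((\<lambda>i. {i}) ` A)" (is "?L = ?R")
  proof (intro set_eqI)
    fix H
    have "H \<in> ?L \<longleftrightarrow> H \<subseteq> A \<and> card H \<noteq> 0 \<and> card H \<noteq> 1" by auto
    also have "\<dots> \<longleftrightarrow> H \<in> ?R"
      using assms finite_subset[of H A] by (auto simp: card_1_singleton_iff)
    finally show "H \<in> ?L \<longleftrightarrow> H \<in> ?R" .
  qed
  moreover have "card (insert {} ((\<lambda>i. {i}) ` A)) = Suc (card A)"
    using assms by (subst card_insert_disjoint) (auto simp: card_image)
  moreover have "insert {} ((\<lambda>i. {i}) ` A) \<subseteq> Pow A" by auto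
  ultimately show ?thesis
    using assms by (simp add: card_Diff_subset finite_subset card_Pow)
qed

lemma theta_singleton:
  assumes "c \<in> coeff_polytope n" "i \<in> {1..n}"
  shows "theta n c {i} = 1"
  using assms by (simp add: theta_def coeff_polytope_def)

text \<open>One coefficient vector for each \<open>H\<close> with at least two elements. On the
  empty set and on singletons \<open>D\<close> and every \<open>theta\<close> are forced to be 0 and
  1, so any of these vectors attains \<open>D\<close> there.\<close>

lemma max_theta_rep_of_gpt_profile:
  assumes n: "2 \<le> n" and F: "gpt_profile n F"
    and D: "\<forall>H\<subseteq>{1..n}. D H = real (card H) - F H"
  shows "max_theta_rep n (2 ^ n - n - 1) D"
proof -
  obtain K s where s: "\<And>i. i \<in> {1..n} \<Longrightarrow> s i \<in> K"
    and mixK: "\<And>p q u. p \<in> K \<Longrightarrow> q \<in> K \<Longrightarrow> u \<in> {0..1} \<Longrightarrow> mix u p q \<in> K"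
    and FK: "\<And>H. H \<subseteq> {1..n} \<Longrightarrow> F H = error_profile K s H"
    using F unfolding gpt_profile_def profile_realized_in_def gpt_state_space_def by metis
  have DK: "D H = opt_success K s H" if "H \<subseteq> {1..n}" for H
    using D FK[OF that] that by (simp add: error_profile_def)
  define \<H> where "\<H> = {H. H \<subseteq> {1..n} \<and> 2 \<le> card H}"
  have cardH: "card \<H> = 2 ^ n - n - 1"
    unfolding \<H>_def using card_subsets_two_elements[of "{1..n}"] by simp
  have fin: "finite \<H>" unfolding \<H>_def by simp
  \<comment> \<open>This uses \<open>n \<ge> 2\<close> and provides the vector used for empty and
    singleton \<open>G\<close>.\<close>
  have "{1..n} \<in> \<H>" using n by (simp add: \<H>_def)
  have "\<forall>H\<in>\<H>. \<exists>c. c \<in> coeff_polytope n \<and> theta n c H = opt_success K s H \<and>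
    (\<forall>G\<subseteq>{1..n}. theta n c G \<le> opt_success K s G)"
  proof
    fix H assume "H \<in> \<H>"
    then have "H \<subseteq> {1..n}" "H \<noteq> {}" by (auto simp: \<H>_def)
    from theta_representation_of_optimum[OF this s mixK]
    show "\<exists>c. c \<in> coeff_polytope n \<and> theta n c H = opt_success K s H \<and>
      (\<forall>G\<subseteq>{1..n}. theta n c G \<le> opt_success K s G)"
      by (simp only: Bex_def)
  qed
  from bchoice[OF this] obtain C where C': "\<forall>H\<in>\<H>. C H \<in> coeff_polytope n \<and>
    theta n (C H) H = opt_success K s H \<and> (\<forall>G\<subseteq>{1..n}. theta n (C H) G \<le> opt_success K s G)"
    by (elim exE)
  then have C: "\<And>H. H \<in> \<H> \<Longrightarrow> C H \<in> coeff_polytope n"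
    "\<And>H. H \<in> \<H> \<Longrightarrow> theta n (C H) H = opt_success K s H"
    "\<And>H G. H \<in> \<H> \<Longrightarrow> G \<subseteq> {1..n} \<Longrightarrow> theta n (C H) G \<le> opt_success K s G"
    by blast+
  obtain \<phi> where \<phi>: "bij_betw \<phi> {1..2 ^ n - n - 1} \<H>"
    using ex_bij_betw_nat_finite_1[OF fin] cardH by auto
  have img: "(\<lambda>\<alpha>. theta n (C (\<phi> \<alpha>)) G) ` {1..2 ^ n - n - 1} = (\<lambda>H. theta n (C H) G) ` \<H>" for G
    using bij_betw_imp_surj_on[OF \<phi>] by auto
  have "D G = Max ((\<lambda>H. theta n (C H) G) ` \<H>)" if G: "G \<subseteq> {1..n}" for G
  proof -
    have "\<exists>H\<in>\<H>. D G = theta n (C H) G"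
    proof (cases "G \<in> \<H>")
      case True
      then show ?thesis using C(2) DK[OF G] by (intro bexI[of _ G]) auto
    next
      case False
      then have "card G = 0 \<or> card G = 1" using G by (auto simp: \<H>_def)
      then consider "G = {}" | i where "G = {i}" "i \<in> {1..n}"
        using G finite_subset[OF G] by (auto simp: card_1_singleton_iff)
      then have "D G = theta n (C {1..n}) G"
      proof cases
        case 1
        then show ?thesis using DK[OF G] by (simp add: opt_success_def theta_def)
      next
        case 2
        obtain e where "measurement K {i} e" "opt_success K s {i} = e i (s i)"
          using opt_success_attained(1)[of "{i}" s K] s mixK 2 by fastforce
        then have "opt_success K s {i} = 1" using s 2 by (simp add: measurement_def)
        then show ?thesis
          using DK[OF G] 2 theta_singleton[OF C(1)[OF \<open>{1..n} \<in> \<H>\<close>]] by simp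
      qed
      then show ?thesis using \<open>{1..n} \<in> \<H>\<close> by blast
    qed
    then show ?thesis
      using C(3) G DK[OF G] fin by (intro Max_eqI[symmetric]) (auto simp: image_iff)
  qed
  then have "\<forall>G\<subseteq>{1..n}. D G = Max ((\<lambda>\<alpha>. theta n (C (\<phi> \<alpha>)) G) ` {1..2 ^ n - n - 1})"
    unfolding img by blast
  moreover have "\<forall>\<alpha>\<in>{1..2 ^ n - n - 1}. C (\<phi> \<alpha>) \<in> coeff_polytope n"
    using C(1) bij_betwE[OF \<phi>] by blast
  ultimately show ?thesis
    unfolding max_theta_rep_def by (intro exI[of _ "\<lambda>\<alpha>. C (\<phi> \<alpha>)"] conjI)
qed

lemma simplex_power_realization:
  assumes "1 \<le> r" and rep: "max_theta_rep n r D"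
    and D: "\<forall>H\<subseteq>{1..n}. D H = real (card H) - F H" and F: "F {} = 0"
  shows "profile_realized_in n F (simplex_power r (2 ^ n))"
proof -
  define M :: nat where "M = 2 ^ n"
  obtain c where c: "\<And>\<alpha>. \<alpha> \<in> {1..r} \<Longrightarrow> c \<alpha> \<in> coeff_polytope n"
    and Dc: "\<And>H. H \<subseteq> {1..n} \<Longrightarrow> D H = Max ((\<lambda>\<alpha>. theta n (c \<alpha>) H) ` {1..r})"
    using rep unfolding max_theta_rep_def by blast
  \<comment> \<open>Vertices are labelled by all subsets, the empty one included; it gets weight 0
    in every state, since no \<open>i\<close> belongs to it.\<close>
  obtain \<phi> where \<phi>: "bij_betw \<phi> {..<M} (Pow {1..n})"
    using ex_bij_betw_nat_finite[of "Pow {1..n}"] by (auto simp: M_def card_Pow lessThan_atLeast0)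
  \<comment> \<open>Components are counted from 0 and coefficient vectors from 1, hence the
    \<open>Suc\<close>.\<close>
  define s where "s = (\<lambda>i l. if l < r * M \<and> i \<in> \<phi> (l mod M) then c (Suc (l div M)) (\<phi> (l mod M)) else 0)"
  have s_block: "s i (k * M + j) = (if i \<in> \<phi> j then c (Suc k) (\<phi> j) else 0)" if "k < r" "j < M" for i k j
    using that by (simp add: s_def block_index_less)
  have sub: "\<phi> j \<subseteq> {1..n}" if "j < M" for j using bij_betwE[OF \<phi>] that by auto
  have c_nonneg: "0 \<le> c \<alpha> B" if "\<alpha> \<in> {1..r}" "B \<subseteq> {1..n}" "B \<noteq> {}" for \<alpha> B
    using c[OF that(1)] that(2,3) by (auto simp: coeff_polytope_def PiE_iff)
  have sum_\<phi>: "(\<Sum>j<M. h (\<phi> j)) = (\<Sum>B\<in>Pow {1..n}. h B)" for h :: "_ \<Rightarrow> real"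
    using sum.reindex_bij_betw[OF \<phi>] by simp
  have sK: "s i \<in> simplex_power r M" if i: "i \<in> {1..n}" for i
    unfolding simplex_power_iff
  proof (intro conjI allI impI)
    show "s i l = 0" if "r * M \<le> l" for l using that by (simp add: s_def)
    show "0 \<le> s i (k * M + j)" if "k < r" "j < M" for k j
      using that sub[of j] c_nonneg[of "Suc k" "\<phi> j"] by (auto simp: s_block)
    show "(\<Sum>j<M. s i (k * M + j)) = 1" if "k < r" for k
    proof -
      have "(\<Sum>j<M. s i (k * M + j)) = (\<Sum>j<M. if i \<in> \<phi> j then c (Suc k) (\<phi> j) else 0)"
        using that by (intro sum.cong) (auto simp: s_block)
      also have "\<dots> = (\<Sum>B\<in>Pow {1..n}. if i \<in> B then c (Suc k) B else 0)" by (rule sum_\<phi>)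
      also have "\<dots> = (\<Sum>B\<in>{B. B \<subseteq> {1..n} \<and> i \<in> B}. c (Suc k) B)"
        by (simp add: sum.inter_filter[symmetric])
      also have "\<dots> = 1" using c[of "Suc k"] that i by (simp add: coeff_polytope_def)
      finally show ?thesis .
    qed
  qed
  have opt: "opt_success (simplex_power r M) s H = D H" if H: "H \<subseteq> {1..n}" for H
  proof (cases "H = {}")
    case True
    then show ?thesis using D F by (simp add: opt_success_def)
  next
    case False
    have finH: "finite H" using H finite_subset by blast
    have Y: "(\<Sum>j<M. Max ((\<lambda>i. s i (k * M + j)) ` H)) = theta n (c (Suc k)) H" if "k < r" for k
    proof -
      \<comment> \<open>At vertex \<open>j\<close> a state has weight
        \<open>c (Suc k) (\<phi> j)\<close> or 0, according to whether \<open>i\<close> lies in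
        \<open>\<phi> j\<close>; by nonnegativity the former is the maximum as soon as
        \<open>\<phi> j\<close> meets \<open>H\<close>.\<close>
      have "Max ((\<lambda>i. s i (k * M + j)) ` H) = (if \<phi> j \<inter> H \<noteq> {} then c (Suc k) (\<phi> j) else 0)"
        if "j < M" for j
      proof (intro Max_eqI)
        show "finite ((\<lambda>i. s i (k * M + j)) ` H)" using finH by simp
        show "t \<le> (if \<phi> j \<inter> H \<noteq> {} then c (Suc k) (\<phi> j) else 0)"
          if "t \<in> (\<lambda>i. s i (k * M + j)) ` H" for t
          using that \<open>j < M\<close> \<open>k < r\<close> sub c_nonneg[of "Suc k" "\<phi> j"] by (auto simp: s_block)
        show "(if \<phi> j \<inter> H \<noteq> {} then c (Suc k) (\<phi> j) else 0) \<in> (\<lambda>i. s i (k * M + j)) ` H"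
          using \<open>j < M\<close> \<open>k < r\<close> False by (auto simp: s_block image_iff)
      qed
      then have "(\<Sum>j<M. Max ((\<lambda>i. s i (k * M + j)) ` H))
          = (\<Sum>j<M. if \<phi> j \<inter> H \<noteq> {} then c (Suc k) (\<phi> j) else 0)"
        by (intro sum.cong) auto
      also have "\<dots> = (\<Sum>B\<in>Pow {1..n}. if B \<inter> H \<noteq> {} then c (Suc k) B else 0)" by (rule sum_\<phi>)
      also have "\<dots> = theta n (c (Suc k)) H"
        by (simp add: theta_def sum.inter_filter[symmetric])
      finally show ?thesis .
    qed
    have "opt_success (simplex_power r M) s H
        = Max ((\<lambda>k. \<Sum>j<M. Max ((\<lambda>i. s i (k * M + j)) ` H)) ` {..<r})"
      using assms(1) sK H False finH by (intro opt_success_simplex_power) (auto simp: M_def)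
    also have "(\<lambda>k. \<Sum>j<M. Max ((\<lambda>i. s i (k * M + j)) ` H)) ` {..<r}
        = (\<lambda>k. theta n (c (Suc k)) H) ` {..<r}"
      using Y by (intro image_cong) auto
    also have "\<dots> = (\<lambda>\<alpha>. theta n (c \<alpha>) H) ` {1..r}"
      by (simp only: image_Suc_lessThan[symmetric] image_image)
    finally show ?thesis using Dc[OF H] by simp
  qed
  have "F H = error_profile (simplex_power r M) s H" if "H \<subseteq> {1..n}" for H
    using opt[OF that] D that by (simp add: error_profile_def)
  then show ?thesis
    unfolding profile_realized_in_def M_def[symmetric] using sK by blast
qed

text \<open>\<open>card H\<close> does not depend on \<open>\<alpha>\<close>, so subtracting from it
  exchanges \<open>Max\<close> and \<open>Min\<close>; \<open>1 \<le> r\<close> keeps the index set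
  nonempty.\<close>

lemma min_E_rep_iff_max_theta_rep:
  assumes "1 \<le> r" and D: "\<forall>H\<subseteq>{1..n}. D H = real (card H) - F H"
  shows "min_E_rep n r F \<longleftrightarrow> max_theta_rep n r D"
proof -
  have "Min ((\<lambda>\<alpha>. E_fun n (c \<alpha>) H) ` {1..r}) = real (card H) - Max ((\<lambda>\<alpha>. theta n (c \<alpha>) H) ` {1..r})"
    for c H
  proof -
    have fin: "finite ((\<lambda>\<alpha>. theta n (c \<alpha>) H) ` {1..r})" by simp
    obtain \<alpha> where "\<alpha> \<in> {1..r}" "Max ((\<lambda>\<alpha>. theta n (c \<alpha>) H) ` {1..r}) = theta n (c \<alpha>) H"
      by (rule obtains_MAX[of "{1..r}" "\<lambda>\<alpha>. theta n (c \<alpha>) H"]) (use assms(1) in auto)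
    moreover have "theta n (c \<beta>) H \<le> Max ((\<lambda>\<alpha>. theta n (c \<alpha>) H) ` {1..r})" if "\<beta> \<in> {1..r}" for \<beta>
      using that fin by (intro Max_ge) auto
    ultimately show ?thesis by (intro Min_eqI) (auto simp: E_fun_def image_iff)
  qed
  then show ?thesis
    unfolding min_E_rep_def max_theta_rep_def using D
    by (intro ex_cong1 conj_cong refl all_cong1 imp_cong) auto
qed

theorem theorem4p1:
  fixes n :: nat and F D :: "nat set \<Rightarrow> real"
  assumes "2 \<le> n"
    and "F {} = 0"
    and "\<forall>H\<subseteq>{1..n}. D H = real (card H) - F H"
  shows "(gpt_profile n F \<longleftrightarrow> (\<exists>r\<ge>1. max_theta_rep n r D))
    \<and> (gpt_profile n F \<longleftrightarrow> (\<exists>r\<ge>1. min_E_rep n r F))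
    \<and> (gpt_profile n F \<longrightarrow>
         (\<exists>r. 1 \<le> r \<and> r \<le> 2 ^ n - n - 1 \<and> max_theta_rep n r D)
       \<and> (\<exists>r. 1 \<le> r \<and> r \<le> 2 ^ n - n - 1 \<and> min_E_rep n r F)
       \<and> (\<exists>ms. ms \<noteq> [] \<and> (\<forall>m\<in>set ms. 1 \<le> m)
             \<and> gpt_state_space (sum_list ms) (simplex_product ms)
             \<and> profile_realized_in n F (simplex_product ms)))"
proof -
  define R :: nat where "R = 2 ^ n - n - 1"
  \<comment> \<open>Since \<open>n \<ge> 2\<close>, the full set is itself among the counted
    subsets, which gives \<open>1 \<le> R\<close>.\<close>
  have "card {{1..n}} \<le> card {H. H \<subseteq> {1..n} \<and> 2 \<le> card H}"
    using assms(1) by (intro card_mono) auto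
  then have R: "1 \<le> R"
    using card_subsets_two_elements[of "{1..n}"] by (simp add: R_def)
  note swap = min_E_rep_iff_max_theta_rep[OF _ assms(3)]
  have max: "max_theta_rep n R D" if "gpt_profile n F"
    unfolding R_def using assms that by (intro max_theta_rep_of_gpt_profile)
  have gpt: "gpt_state_space (sum_list (replicate r (2 ^ n))) (simplex_power r (2 ^ n))" if "1 \<le> r" for r
    using that by (intro gpt_state_space_simplex_power) auto
  have real: "profile_realized_in n F (simplex_power r (2 ^ n))" if "1 \<le> r" "max_theta_rep n r D" for r
    using that assms by (intro simplex_power_realization)
  \<comment> \<open>For the backward direction the simplex power itself serves as the state
    space.\<close>
  have iff: "gpt_profile n F \<longleftrightarrow> (\<exists>r\<ge>1. max_theta_rep n r D)"
    using max R gpt real unfolding gpt_profile_def by blast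
  show ?thesis
  proof (intro conjI impI)
    show "gpt_profile n F \<longleftrightarrow> (\<exists>r\<ge>1. max_theta_rep n r D)" by (fact iff)
    show "gpt_profile n F \<longleftrightarrow> (\<exists>r\<ge>1. min_E_rep n r F)" using iff swap by blast
    assume "gpt_profile n F"
    note m = max[OF this]
    show "\<exists>r. 1 \<le> r \<and> r \<le> 2 ^ n - n - 1 \<and> max_theta_rep n r D"
      using m R unfolding R_def by blast
    show "\<exists>r. 1 \<le> r \<and> r \<le> 2 ^ n - n - 1 \<and> min_E_rep n r F"
      using m R swap[OF R] unfolding R_def by blast
    show "\<exists>ms. ms \<noteq> [] \<and> (\<forall>m\<in>set ms. 1 \<le> m) \<and>
        gpt_state_space (sum_list ms) (simplex_product ms) \<and> profile_realized_in n F (simplex_product ms)"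
      using R gpt[OF R] real[OF R m] by (intro exI[of _ "replicate R (2 ^ n)"]) auto
  qed
qed

end
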